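(* Let $N$ be a positive integer and let $\alpha,\beta,\zeta$ be real parameters that are generic (no denominator appearing below or in the context vanishes). Write $\mathcal U_m(n)=\mathcal U_m(n;\alpha,\beta,\zeta,N)$ as defined in the context, and put $$\mathcal B_n=(n-N)(n+N-2\alpha-\beta-2\zeta)(n-\alpha+\beta+1),\qquad \mathcal D_n=n(n-2\alpha+\beta)(n-\alpha-\beta-2\zeta-1).$$ Then for all $m,n\in\{0,\dots,N\}$ $$\mathcal B_n\,\mathcal U_m(n+1)-(\mathcal B_n+\mathcal D_n)\,\mathcal U_m(n)+\mathcal D_n\,\mathcal U_m(n-1)$$ $$=m(2\beta+2\zeta+1-m)\left((n-\alpha)\,\mathcal U_m(n)-\frac{n(n-2\alpha+\beta)}{n-\alpha+\beta}\,\mathcal U_m(n-1)\right).$$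
   Context: Notation: $(a)_n=a(a+1)\cdots(a+n-1)$, $(a)_0=1$, and $(a_1,\dots,a_k)_n=(a_1)_n\cdots(a_k)_n$. For $m,n\in\{0,\dots,N\}$, $$\mathcal U_m(n;a,b,c,N)={}_4F_3\left({-m,\ -n,\ -a,\ m-2b-2c-1\atop -N,\ a-b-n,\ N-2a-b-2c};1\right)=\sum_{\ell=0}^{\min(m,n)}\frac{(-m,-n,-a,m-2b-2c-1)_\ell}{\ell!\,(-N,a-b-n,N-2a-b-2c)_\ell}.$$ Since $\mathcal B_N=0$, $\mathcal D_0=0$ and the last term carries a factor $n$, the terms involving $\mathcal U_m(N+1)$ and $\mathcal U_m(-1)$ are understood to be zero. *)

theory Defs
  imports Complex_Main
begin

text \<open>
  The terminating \<open>\<^sub>4F\<^sub>3\<close> series at argument 1, with the summation cut off at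
  \<open>min m n\<close>.  The bound matters: the lower parameter \<open>-N\<close> is a nonpositive integer, so the
  series is only meaningful as this finite sum.
  The degree variable \<open>n\<close> is an integer so that \<open>n - 1\<close> and \<open>n + 1\<close> may leave
  \<open>{0..N}\<close>; the function is zero there.
\<close>

definition hypU :: "nat \<Rightarrow> int \<Rightarrow> real \<Rightarrow> real \<Rightarrow> real \<Rightarrow> nat \<Rightarrow> real" where
  "hypU m n a b c N =
    (if 0 \<le> n \<and> n \<le> int N then
       (\<Sum>l = 0..min m (nat n).
          (pochhammer (- real m) l * pochhammer (- real_of_int n) l * pochhammer (- a) l
             * pochhammer (real m - 2 * b - 2 * c - 1) l)
          / (fact l * (pochhammer (- real N) l * pochhammer (a - b - real_of_int n) l
             * pochhammer (real N - 2 * a - b - 2 * c) l)))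
     else 0)"

text \<open>
  Genericity: none of the denominators occurring in the series for \<open>m, n \<in> {0..N}\<close>, nor the
  denominator \<open>n - a + b\<close> of the contiguity relation, vanishes.
\<close>

definition generic_params :: "real \<Rightarrow> real \<Rightarrow> real \<Rightarrow> nat \<Rightarrow> bool" where
  "generic_params a b c N \<longleftrightarrow>
    (\<forall>m\<in>{0..N}. \<forall>n\<in>{0..N}. \<forall>l\<in>{0..min m n}.
       pochhammer (- real N) l * pochhammer (a - b - real n) l
         * pochhammer (real N - 2 * a - b - 2 * c) l \<noteq> 0)
    \<and> (\<forall>n\<in>{0..N}. real n - a + b \<noteq> 0)"

definition coeffB :: "real \<Rightarrow> real \<Rightarrow> real \<Rightarrow> nat \<Rightarrow> nat \<Rightarrow> real" where
  "coeffB a b c N n =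
    (real n - real N) * (real n + real N - 2 * a - b - 2 * c) * (real n - a + b + 1)"

definition coeffD :: "real \<Rightarrow> real \<Rightarrow> real \<Rightarrow> nat \<Rightarrow> real" where
  "coeffD a b c n = real n * (real n - 2 * a + b) * (real n - a - b - 2 * c - 1)"

end

theory Submission
  imports Defs
begin

text \<open>
  Write \<open>s = 2\<beta> + 2\<zeta> + 1\<close>.  The point is that \<open>m\<close> enters the series only through
  the products \<open>Q\<^sub>l = (-m)\<^sub>l (m - s)\<^sub>l\<close>, and that these products turn multiplication by the
  eigenvalue \<open>m (s - m)\<close> into a two-term shift in \<open>l\<close>: since
  \<open>(l - m) (l + m - s) = m (s - m) + l (l - s)\<close>,
  \[ m (s - m)\, Q_l = Q_{l+1} - l (l - s)\, Q_l , \]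
  while \<open>Q\<^sub>m\<^sub>+\<^sub>1 = 0\<close>.  With \<open>u\<^sub>l(n)\<close> denoting the coefficient of \<open>Q\<^sub>l\<close> in the series, the
  claim therefore follows by comparing coefficients of \<open>Q\<^sub>l\<close>
  (\<open>eigenvalue_summation_by_parts\<close>), which leaves an identity free of \<open>m\<close>
  between \<open>u\<^sub>l(n + 1)\<close>, \<open>u\<^sub>l(n)\<close>, \<open>u\<^sub>l(n - 1)\<close>, \<open>u\<^sub>l\<^sub>-\<^sub>1(n)\<close> and \<open>u\<^sub>l\<^sub>-\<^sub>1(n - 1)\<close>.  With the
  multipliers they carry, all of these are rational multiples of \<open>u\<^sub>l\<^sub>-\<^sub>1(n)\<close>
  (\<open>coeffB_U_coeff_Suc\<close>, \<open>U_coeff_Suc\<close>, \<open>U_coeff_pred\<close>), so one polynomial identity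
  remains (\<open>coefficient_recurrence_rational\<close>).

  The genericity hypothesis controls the denominators \<open>\<alpha> - \<beta> - n + l\<close> only for
  \<open>l \<le> n\<close>.  For larger \<open>l\<close> the numerator \<open>(-n)\<^sub>l\<close> vanishes, and with
  \<open>x / 0 = 0\<close> so does the coefficient; this is also why every sum may be taken over
  \<open>l \<le> m\<close>, whatever the degree.
\<close>

definition U_coeff :: "real \<Rightarrow> real \<Rightarrow> real \<Rightarrow> nat \<Rightarrow> nat \<Rightarrow> real \<Rightarrow> real" where
  "U_coeff a b c N l x =
    pochhammer (- x) l * pochhammer (- a) l
      / (fact l * pochhammer (- real N) l * pochhammer (a - b - x) l
          * pochhammer (real N - 2 * a - b - 2 * c) l)"

text \<open>The factor by which the part of the coefficient independent of the degree grows with \<open>l\<close>.\<close>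

definition U_ratio :: "real \<Rightarrow> real \<Rightarrow> real \<Rightarrow> nat \<Rightarrow> nat \<Rightarrow> real" where
  "U_ratio a b c N k =
    (real k - a) / ((real k + 1) * (real k - real N) * (real N - 2 * a - b - 2 * c + real k))"

definition eigen_prod :: "nat \<Rightarrow> real \<Rightarrow> nat \<Rightarrow> real" where
  "eigen_prod m s l = pochhammer (- real m) l * pochhammer (real m - s) l"

section \<open>Expansion of the series in the products carrying the eigenvalue\<close>

lemma eigen_prod_Suc:
  "eigen_prod m s (Suc l)
     = (real m * (s - real m) + real l * (real l - s)) * eigen_prod m s l"
  by (simp add: eigen_prod_def pochhammer_Suc algebra_simps)

lemma eigen_prod_eq_0: "m < l \<Longrightarrow> eigen_prod m s l = 0"
  by (simp add: eigen_prod_def pochhammer_of_nat_eq_0_lemma)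

lemma U_coeff_eq_0: "n < l \<Longrightarrow> U_coeff a b c N l (real n) = 0"
  by (simp add: U_coeff_def pochhammer_of_nat_eq_0_lemma)

lemma hypU_expansion:
  assumes "n \<le> N"
  shows "hypU m (int n) a b c N
           = (\<Sum>l\<le>m. eigen_prod m (2 * b + 2 * c + 1) l * U_coeff a b c N l (real n))"
proof -
  have "hypU m (int n) a b c N
      = (\<Sum>l\<in>{0..min m n}. eigen_prod m (2 * b + 2 * c + 1) l * U_coeff a b c N l (real n))"
    using assms
    by (simp add: hypU_def eigen_prod_def U_coeff_def algebra_simps)
  also have "\<dots> = (\<Sum>l\<le>m. eigen_prod m (2 * b + 2 * c + 1) l * U_coeff a b c N l (real n))"
    by (rule sum.mono_neutral_left) (auto simp: U_coeff_eq_0)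
  finally show ?thesis .
qed

text \<open>
  Multiplying \<open>Q\<^sub>l\<close> by the eigenvalue gives \<open>Q\<^sub>l\<^sub>+\<^sub>1 - l (l - s) Q\<^sub>l\<close>; collecting the
  contributions to each \<open>Q\<^sub>l\<close> leaves only the shifted term of index \<open>M\<close> unpaired.  For \<open>M = m\<close>
  it vanishes.
\<close>

lemma eigenvalue_summation_by_parts:
  assumes "e 0 = 0"
    and "\<And>k. k < M \<Longrightarrow> e (Suc k) = g k - (real k + 1) * (real k + 1 - s) * g (Suc k)"
  shows "real m * (s - real m) * (\<Sum>l\<le>M. eigen_prod m s l * g l)
           = (\<Sum>l\<le>M. eigen_prod m s l * e l) + eigen_prod m s (Suc M) * g M"
  using assms(2)
proof (induction M)
  case 0
  then show ?case
    by (simp add: assms(1) eigen_prod_Suc)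
next
  case (Suc M)
  have IH: "real m * (s - real m) * (\<Sum>l\<le>M. eigen_prod m s l * g l)
           = (\<Sum>l\<le>M. eigen_prod m s l * e l) + eigen_prod m s (Suc M) * g M"
    using Suc by simp
  have e: "e (Suc M) = g M - (real M + 1) * (real M + 1 - s) * g (Suc M)"
    using Suc.prems by simp
  show ?case
    by (simp add: distrib_left IH e eigen_prod_Suc[of m s "Suc M"]) (simp add: algebra_simps)
qed

section \<open>Contiguity of the coefficients\<close>

lemma U_coeff_Suc:
  "U_coeff a b c N (Suc k) x
     = (real k - x) / (a - b - x + real k) * U_ratio a b c N k * U_coeff a b c N k x"
  by (simp add: U_coeff_def U_ratio_def pochhammer_Suc algebra_simps)

text \<open>
  The factor \<open>n - a + b + 1\<close> of \<open>B\<^sub>n\<close> cancels the one denominator factor that raising the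
  degree introduces; for \<open>n = N\<close> that denominator may vanish, but then so does \<open>B\<^sub>n\<close>.
\<close>

lemma coeffB_U_coeff_Suc:
  assumes "n = N \<or> real n - a + b + 1 \<noteq> 0"
  shows "coeffB a b c N n * U_coeff a b c N (Suc k) (real n + 1)
     = (real n - real N) * (real n + real N - 2 * a - b - 2 * c) * (real n + 1)
         * U_ratio a b c N k * U_coeff a b c N k (real n)"
proof (cases "n = N")
  case True
  then show ?thesis by (simp add: coeffB_def)
next
  case False
  define w where "w = a - b - real n"
  have w: "w - 1 \<noteq> 0" using False assms by (simp add: w_def)
  have num: "pochhammer (- (real n + 1)) (Suc k) = - (real n + 1) * pochhammer (- real n) k"
    by (simp add: pochhammer_rec)
  have den: "pochhammer (a - b - (real n + 1)) (Suc k) = (w - 1) * pochhammer w k"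
    by (simp add: pochhammer_rec w_def algebra_simps)
  have B: "coeffB a b c N n
      = - (w - 1) * ((real n - real N) * (real n + real N - 2 * a - b - 2 * c))"
    by (simp add: coeffB_def w_def algebra_simps)
  have eq: "U_coeff a b c N (Suc k) (real n + 1)
      = - (real n + 1) / (w - 1) * (U_ratio a b c N k * U_coeff a b c N k (real n))"
    unfolding U_coeff_def num den
    by (simp add: U_ratio_def pochhammer_Suc w_def[symmetric] ac_simps)
  have "(w - 1) * U_coeff a b c N (Suc k) (real n + 1)
      = - (real n + 1) * (U_ratio a b c N k * U_coeff a b c N k (real n))"
    unfolding eq using w by simp
  then show ?thesis unfolding B by algebra
qed

text \<open>
  With \<open>w = a - b - n\<close>, one has \<open>n (1 - n)\<^sub>k = -(-n)\<^sub>k\<^sub>+\<^sub>1\<close> and \<open>w (w + 1)\<^sub>k = (w)\<^sub>k\<^sub>+\<^sub>1\<close>;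
  splitting off the last factors \<open>k - n\<close> and \<open>w + k\<close> leaves \<open>(-n)\<^sub>k\<close> and \<open>(w)\<^sub>k\<close>.
  If \<open>w + k = 0\<close>, the first assumption forces \<open>k > n\<close>, and both sides vanish.
\<close>

lemma U_coeff_pred:
  assumes gen: "\<And>j. j \<le> N \<Longrightarrow> a - b \<noteq> real j" and "n \<le> N"
  shows "real n * U_coeff a b c N k (real n - 1)
     = (real n - real k) * (a - b - real n) / (a - b - real n + real k)
         * U_coeff a b c N k (real n)"
proof (cases "k \<le> n")
  case True
  define w where "w = a - b - real n"
  have w: "w \<noteq> 0" using gen[OF \<open>n \<le> N\<close>] by (simp add: w_def)
  have wk: "w + real k \<noteq> 0"
    using gen[of "n - k"] \<open>n \<le> N\<close> unfolding w_def of_nat_diff[OF True] by linarith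
  have num: "real n * pochhammer (- (real n - 1)) k = (real n - real k) * pochhammer (- real n) k"
    using pochhammer_rec[of "- real n" k] pochhammer_Suc[of "- real n" k]
    by (simp add: algebra_simps)
  have den: "w * pochhammer (w + 1) k = (w + real k) * pochhammer w k"
    using pochhammer_rec[of w k] pochhammer_Suc[of w k] by (simp add: algebra_simps)
  have den': "1 / pochhammer (w + 1) k = w / ((w + real k) * pochhammer w k)"
    using w by (simp add: den[symmetric])
  define C where "C = pochhammer (- a) k
      / (fact k * pochhammer (- real N) k * pochhammer (real N - 2 * a - b - 2 * c) k)"
  have "real n * U_coeff a b c N k (real n - 1)
      = (real n * pochhammer (- (real n - 1)) k) * (1 / pochhammer (w + 1) k) * C"
    by (simp add: U_coeff_def C_def w_def algebra_simps)
  also have "\<dots> = (real n - real k) * w / (w + real k)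
      * (pochhammer (- real n) k / pochhammer w k * C)"
    unfolding num den' by (simp add: ac_simps)
  also have "pochhammer (- real n) k / pochhammer w k * C = U_coeff a b c N k (real n)"
    by (simp add: U_coeff_def C_def w_def algebra_simps)
  finally show ?thesis by (simp add: w_def)
next
  case False
  have "real n * U_coeff a b c N k (real n - 1) = 0"
  proof (cases n)
    case (Suc n')
    then show ?thesis using False U_coeff_eq_0[of n' k a b c N] by simp
  qed simp
  then show ?thesis using False by (simp add: U_coeff_eq_0)
qed

section \<open>The recurrence between coefficients\<close>

text \<open>
  Here \<open>x\<close> is the degree, \<open>w = a - b - x\<close>, \<open>q = N - 2a - b - 2c\<close> and \<open>r\<close> is the ratio from
  index \<open>k\<close> to \<open>k + 1\<close>; every coefficient has been divided by the one of index \<open>k\<close> and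
  degree \<open>x\<close>.
\<close>

lemma coefficient_recurrence_rational:
  fixes x k M a b c w q r :: real
  assumes w: "w = a - b - x" and q: "q = M - 2 * a - b - 2 * c"
    and r: "r = (k - a) / ((k + 1) * (k - M) * (q + k))"
    and nz: "k + 1 \<noteq> 0" "k - M \<noteq> 0" "q + k \<noteq> 0" "w + k \<noteq> 0"
    and edge: "k = x \<or> w + k + 1 \<noteq> 0"
  shows "(x - M) * (x + q) * (x + 1) * r
      - ((x - M) * (x + q) * (x - a + b + 1) + x * (x - 2 * a + b) * (x - a - b - 2 * c - 1))
          * ((k - x) / (w + k) * r)
      + (x - 2 * a + b) * (x - a - b - 2 * c - 1)
          * ((x - (k + 1)) * w / (w + k + 1) * ((k - x) / (w + k) * r))
    = (x - a) - (x - 2 * a + b) * ((k - x) / (w + k))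
      - (k + 1) * (k - 2 * b - 2 * c)
          * ((x - a) * ((k - x) / (w + k) * r)
             - (x - 2 * a + b) * ((k + 1 - x) / (w + k + 1) * ((k - x) / (w + k) * r)))"
proof (cases "k = x")
  case True
  then show ?thesis using nz by (simp add: r) (simp add: field_simps)
next
  case False
  then have nz': "w + k + 1 \<noteq> 0" using edge by simp
  define P where "P = (k + 1) * (k - M) * (q + k)"
  have P: "P \<noteq> 0" using nz by (simp add: P_def)
  have rP: "r = (k - a) / P" by (simp add: r P_def)
  have poly:
    "(k - a) * ((x - M) * (x + q) * (x + 1) * ((w + k) * (w + k + 1))
      - ((x - M) * (x + q) * (x - a + b + 1) + x * (x - 2 * a + b) * (x - a - b - 2 * c - 1))
          * ((k - x) * (w + k + 1))
      + (x - 2 * a + b) * (x - a - b - 2 * c - 1) * ((x - (k + 1)) * w * (k - x)))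
    = P * ((x - a) * ((w + k) * (w + k + 1)) - (x - 2 * a + b) * ((k - x) * (w + k + 1)))
      - (k - a) * ((k + 1) * (k - 2 * b - 2 * c)
          * ((x - a) * ((k - x) * (w + k + 1)) - (x - 2 * a + b) * ((k + 1 - x) * (k - x))))"
    unfolding P_def w q by algebra
  \<comment> \<open>Clearing denominators, with the numerators kept as opaque letters so that their
      expansion is confined to \<open>poly\<close>.\<close>
  let ?A = "w + k" and ?B = "w + k + 1"
  have clear: "X * r - Y * (Z / ?A * r) + V * (T / ?B * (Z / ?A * r))
      = S - R * (Z / ?A) - H * (S * (Z / ?A * r) - R * (G / ?B * (Z / ?A * r)))"
    if "(k - a) * (X * (?A * ?B) - Y * (Z * ?B) + V * (T * Z))
      = P * (S * (?A * ?B) - R * (Z * ?B)) - (k - a) * (H * (S * (Z * ?B) - R * (G * Z)))"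
    for X Y Z V T S R H G
  proof -
    define iA iB iP where "iA = 1 / ?A" and "iB = 1 / ?B" and "iP = 1 / P"
    have "?A * iA = 1" "?B * iB = 1" "P * iP = 1"
      using nz nz' P by (simp_all add: iA_def iB_def iP_def)
    moreover have "r = (k - a) * iP" "Z / ?A = Z * iA" "T / ?B = T * iB" "G / ?B = G * iB"
      by (simp_all add: rP iA_def iB_def iP_def)
    ultimately show ?thesis using that by algebra
  qed
  show ?thesis by (rule clear) (rule poly)
qed

text \<open>
  If \<open>k > n\<close> every term vanishes.  If \<open>k \<le> n\<close> the assumption on \<open>a - b\<close> gives
  \<open>a - b - n + k \<noteq> 0\<close>, and also \<open>a - b - n + k + 1 \<noteq> 0\<close> unless \<open>k = n\<close>, where the factor \<open>k - n\<close> removes that denominator.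
\<close>

lemma coefficient_recurrence:
  fixes n N k :: nat and a b c :: real
  assumes gen: "\<And>j. j \<le> N \<Longrightarrow> a - b \<noteq> real j" and "n \<le> N" and "k < N"
    and q: "real N - 2 * a - b - 2 * c + real k \<noteq> 0"
  defines "u \<equiv> U_coeff a b c N"
  defines "g \<equiv> \<lambda>l. (real n - a) * u l (real n)
      - real n * (real n - 2 * a + b) / (real n - a + b) * u l (real n - 1)"
  shows "coeffB a b c N n * u (Suc k) (real n + 1)
      - (coeffB a b c N n + coeffD a b c n) * u (Suc k) (real n)
      + coeffD a b c n * u (Suc k) (real n - 1)
    = g k - (real k + 1) * (real k + 1 - (2 * b + 2 * c + 1)) * g (Suc k)"
proof -
  define w where "w = a - b - real n"
  define Q where "Q = real N - 2 * a - b - 2 * c"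
  define r where "r = U_ratio a b c N k"
  have w: "w \<noteq> 0" using gen[OF \<open>n \<le> N\<close>] by (simp add: w_def)
  have up: "coeffB a b c N n * u (Suc k) (real n + 1)
      = (real n - real N) * (real n + Q) * (real n + 1) * r * u k (real n)"
  proof -
    have "n = N \<or> real n - a + b + 1 \<noteq> 0"
      using gen[of "Suc n"] \<open>n \<le> N\<close> by auto
    moreover have "real n + real N - 2 * a - b - 2 * c = real n + Q" by (simp add: Q_def)
    ultimately show ?thesis
      using coeffB_U_coeff_Suc[of n N a b c k] by (simp add: u_def r_def)
  qed
  have same: "u (Suc k) (real n) = (real k - real n) / (w + real k) * r * u k (real n)"
    by (simp add: u_def w_def r_def U_coeff_Suc)
  have down: "real n * u l (real n - 1)
      = (real n - real l) * w / (w + real l) * u l (real n)" for l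
    unfolding u_def w_def by (rule U_coeff_pred[OF gen \<open>n \<le> N\<close>])
  have D: "coeffD a b c n * u l (real n - 1) =
      (real n - 2 * a + b) * (real n - a - b - 2 * c - 1)
        * ((real n - real l) * w / (w + real l) * u l (real n))" for l
    unfolding down[symmetric] by (simp add: coeffD_def)
  have G: "g l = (real n - a) * u l (real n)
      - (real n - 2 * a + b) * ((real l - real n) / (w + real l) * u l (real n))" for l
  proof -
    have neg: "- w = real n - a + b" by (simp add: w_def)
    have "real n * (real n - 2 * a + b) / (real n - a + b) * u l (real n - 1)
        = (real n - 2 * a + b) / (- w) * (real n * u l (real n - 1))"
      unfolding neg by (simp add: mult_ac)
    also have "\<dots> = (real n - 2 * a + b) * ((real l - real n) / (w + real l) * u l (real n))"
    proof -
      have "real n * u l (real n - 1) = - w * ((real l - real n) / (w + real l) * u l (real n))"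
        unfolding down by (simp add: divide_inverse algebra_simps)
      then show ?thesis using w by simp
    qed
    finally show ?thesis by (simp add: g_def)
  qed
  show ?thesis
  proof (cases "k \<le> n")
    case False
    then have "u k (real n) = 0" by (simp add: u_def U_coeff_eq_0)
    then show ?thesis by (simp add: up D G same)
  next
    case True
    have wk: "w + real k \<noteq> 0"
      using gen[of "n - k"] \<open>n \<le> N\<close> unfolding w_def of_nat_diff[OF True] by linarith
    have edge: "real k = real n \<or> w + real k + 1 \<noteq> 0"
    proof (cases "k = n")
      case False
      then have "Suc k \<le> n" using True by simp
      then have "a - b \<noteq> real n - real (Suc k)"
        using gen[of "n - Suc k"] \<open>n \<le> N\<close> by (simp add: of_nat_diff)
      then show ?thesis by (auto simp: w_def)
    qed simp
    have r: "r = (real k - a) / ((real k + 1) * (real k - real N) * (Q + real k))"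
      by (simp add: r_def Q_def U_ratio_def)
    have nz: "real k + 1 \<noteq> 0" "real k - real N \<noteq> 0" "Q + real k \<noteq> 0"
      using \<open>k < N\<close> q by (simp_all add: Q_def)
    have B: "coeffB a b c N n = (real n - real N) * (real n + Q) * (real n - a + b + 1)"
      by (simp add: coeffB_def Q_def algebra_simps)
    have S: "real (Suc k) = real k + 1" by simp
    define y z z' where "y = (real k - real n) / (w + real k)"
      and "z = (real n - (real k + 1)) * w / (w + real k + 1)"
      and "z' = (real k + 1 - real n) / (w + real k + 1)"
    have S': "w + (real k + 1) = w + real k + 1" by simp
    show ?thesis
      using coefficient_recurrence_rational[OF w_def Q_def r nz wk edge]
      unfolding up D G same S S' y_def[symmetric] z_def[symmetric] z'_def[symmetric]
      unfolding B coeffD_def by algebra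
  qed
qed

lemma coefficient_recurrence_0:
  "coeffB a b c N n * U_coeff a b c N 0 (real n + 1)
      - (coeffB a b c N n + coeffD a b c n) * U_coeff a b c N 0 (real n)
      + coeffD a b c n * U_coeff a b c N 0 (real n - 1) = 0"
  by (simp add: U_coeff_def)

section \<open>The difference equation\<close>

lemma generic_params_difference:
  assumes "generic_params a b c N" "j \<le> N"
  shows "a - b \<noteq> real j"
  using assms unfolding generic_params_def by force

lemma generic_params_sum:
  assumes "generic_params a b c N" "k < N"
  shows "real N - 2 * a - b - 2 * c + real k \<noteq> 0"
proof
  assume "real N - 2 * a - b - 2 * c + real k = 0"
  then have "pochhammer (real N - 2 * a - b - 2 * c) N = 0"
    using \<open>k < N\<close> by (auto simp: pochhammer_eq_0_iff intro!: exI[of _ k])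
  moreover have "pochhammer (real N - 2 * a - b - 2 * c) N \<noteq> 0"
    using assms(1) unfolding generic_params_def by force
  ultimately show False by simp
qed

theorem proposition8:
  fixes N :: nat and \<alpha> \<beta> \<zeta> :: real
  assumes "N > 0"
    and "generic_params \<alpha> \<beta> \<zeta> N"
  shows "\<forall>m\<in>{0..N}. \<forall>n\<in>{0..N}.
    coeffB \<alpha> \<beta> \<zeta> N n * hypU m (int n + 1) \<alpha> \<beta> \<zeta> N
      - (coeffB \<alpha> \<beta> \<zeta> N n + coeffD \<alpha> \<beta> \<zeta> n) * hypU m (int n) \<alpha> \<beta> \<zeta> N
      + coeffD \<alpha> \<beta> \<zeta> n * hypU m (int n - 1) \<alpha> \<beta> \<zeta> N
    = real m * (2 * \<beta> + 2 * \<zeta> + 1 - real m)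
      * ((real n - \<alpha>) * hypU m (int n) \<alpha> \<beta> \<zeta> N
         - real n * (real n - 2 * \<alpha> + \<beta>) / (real n - \<alpha> + \<beta>)
             * hypU m (int n - 1) \<alpha> \<beta> \<zeta> N)"
proof (intro ballI)
  fix m n :: nat
  assume "m \<in> {0..N}" "n \<in> {0..N}"
  then have m: "m \<le> N" and n: "n \<le> N" by simp_all
  define s where "s = 2 * \<beta> + 2 * \<zeta> + 1"
  define B where "B = coeffB \<alpha> \<beta> \<zeta> N n"
  define D where "D = coeffD \<alpha> \<beta> \<zeta> n"
  define K where "K = real n * (real n - 2 * \<alpha> + \<beta>) / (real n - \<alpha> + \<beta>)"
  define u where "u = U_coeff \<alpha> \<beta> \<zeta> N"
  define V where "V = (\<lambda>x. \<Sum>l\<le>m. eigen_prod m s l * u l x)"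
  define g where "g = (\<lambda>l. (real n - \<alpha>) * u l (real n) - K * u l (real n - 1))"
  define e where "e = (\<lambda>l. B * u l (real n + 1) - (B + D) * u l (real n) + D * u l (real n - 1))"
  have hypV: "hypU m (int n') \<alpha> \<beta> \<zeta> N = V (real n')" if "n' \<le> N" for n'
    using hypU_expansion[OF that] by (simp add: V_def u_def s_def)
  \<comment> \<open>Outside the range \<open>{0..N}\<close> the series is cut to zero while \<open>V\<close> is not, but
      \<open>B\<close> vanishes at \<open>n = N\<close>, and \<open>D\<close> and \<open>K\<close> vanish at \<open>n = 0\<close>.\<close>
  have up: "B * hypU m (int n + 1) \<alpha> \<beta> \<zeta> N = B * V (real n + 1)"
  proof (cases "n = N")
    case True
    then show ?thesis by (simp add: B_def coeffB_def)
  next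
    case False
    then show ?thesis using n hypV[of "Suc n"] by (simp add: add.commute)
  qed
  have down: "n = 0 \<or> hypU m (int n - 1) \<alpha> \<beta> \<zeta> N = V (real n - 1)"
    using n hypV[of "n - 1"] by (cases n) auto
  then have downD: "D * hypU m (int n - 1) \<alpha> \<beta> \<zeta> N = D * V (real n - 1)"
    and downK: "K * hypU m (int n - 1) \<alpha> \<beta> \<zeta> N = K * V (real n - 1)"
    by (auto simp: D_def coeffD_def K_def)
  have e0: "e 0 = 0"
    using coefficient_recurrence_0 by (simp add: e_def B_def D_def u_def)
  have eSuc: "e (Suc k) = g k - (real k + 1) * (real k + 1 - s) * g (Suc k)" if "k < m" for k
    unfolding e_def g_def B_def D_def u_def K_def s_def
    using that m generic_params_difference[OF assms(2)] generic_params_sum[OF assms(2), of k]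
    by (intro coefficient_recurrence n) auto
  have "B * V (real n + 1) - (B + D) * V (real n) + D * V (real n - 1)
      = (\<Sum>l\<le>m. eigen_prod m s l * e l)"
    by (simp add: V_def e_def sum_distrib_left sum.distrib sum_subtractf algebra_simps)
  also have "\<dots> = real m * (s - real m) * (\<Sum>l\<le>m. eigen_prod m s l * g l)"
    using eigenvalue_summation_by_parts[OF e0 eSuc] by (simp add: eigen_prod_eq_0)
  also have "(\<Sum>l\<le>m. eigen_prod m s l * g l) = (real n - \<alpha>) * V (real n) - K * V (real n - 1)"
    by (simp add: V_def g_def sum_distrib_left sum.distrib sum_subtractf algebra_simps)
  finally show "coeffB \<alpha> \<beta> \<zeta> N n * hypU m (int n + 1) \<alpha> \<beta> \<zeta> N
      - (coeffB \<alpha> \<beta> \<zeta> N n + coeffD \<alpha> \<beta> \<zeta> n) * hypU m (int n) \<alpha> \<beta> \<zeta> N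
      + coeffD \<alpha> \<beta> \<zeta> n * hypU m (int n - 1) \<alpha> \<beta> \<zeta> N
    = real m * (2 * \<beta> + 2 * \<zeta> + 1 - real m)
      * ((real n - \<alpha>) * hypU m (int n) \<alpha> \<beta> \<zeta> N
         - real n * (real n - 2 * \<alpha> + \<beta>) / (real n - \<alpha> + \<beta>)
             * hypU m (int n - 1) \<alpha> \<beta> \<zeta> N)"
    unfolding B_def[symmetric] D_def[symmetric] K_def[symmetric] s_def[symmetric]
    unfolding up downD downK hypV[OF n] .
qed

end
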